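(* For every domain $D\subsetneq\mathbb{R}^n$ and all $x,y\in D$, we have $$u_D(x,y)\le 3\,\tilde{j}_D(x,y),$$ and the inequality is sharp.
   Context: A domain is a nonempty open connected set, and $|\cdot|$ is the Euclidean norm. For a domain $D\subsetneq\mathbb{R}^n$ and $x\in D$, $d(x)$ denotes the Euclidean distance from $x$ to the boundary of $D$. The Gromov hyperbolic metric $u_D$ is $$u_D(x,y)=2\log\frac{|x-y|+\max\{d(x),d(y)\}}{\sqrt{d(x)\,d(y)}},\qquad x,y\in D,$$ and the distance ratio metric $\tilde{j}_D$ is $$\tilde{j}_D(x,y)=\frac12\log\left[\left(1+\frac{|x-y|}{d(x)}\right)\left(1+\frac{|x-y|}{d(y)}\right)\right],\qquad x,y\in D.$$ "Sharp" means that the constant $3$ cannot be replaced by a smaller constant valid for all such $D$ and all $x,y\in D$. *)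

theory Defs
  imports "HOL-Analysis.Analysis"
begin

definition domain :: "'a::topological_space set \<Rightarrow> bool" where
  "domain D \<longleftrightarrow> D \<noteq> {} \<and> open D \<and> connected D"

(* infdist x {} = 0 in the library, but a domain D \<noteq> UNIV of a Euclidean space has
   nonempty boundary, so bdist is then the true distance to the boundary. *)
definition bdist :: "'a::metric_space set \<Rightarrow> 'a \<Rightarrow> real" where
  "bdist D x = infdist x (frontier D)"

definition gromov_u :: "'a::real_normed_vector set \<Rightarrow> 'a \<Rightarrow> 'a \<Rightarrow> real" where
  "gromov_u D x y =
     2 * ln ((norm (x - y) + max (bdist D x) (bdist D y)) / sqrt (bdist D x * bdist D y))"

definition dist_ratio :: "'a::real_normed_vector set \<Rightarrow> 'a \<Rightarrow> 'a \<Rightarrow> real" where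
  "dist_ratio D x y =
     1 / 2 * ln ((1 + norm (x - y) / bdist D x) * (1 + norm (x - y) / bdist D y))"

end

theory Submission
  imports Defs "HOL-Real_Asymp.Real_Asymp"
begin

text \<open>
  Put \<open>t = norm (x - y)\<close>, and let \<open>m \<le> M\<close> be the two boundary distances. All that the
  geometry of the domain contributes is that \<open>m\<close> and \<open>M\<close> are positive and that
  \<open>M \<le> m + t\<close>, the boundary distance being 1-Lipschitz. After exponentiation and cancellation
  the inequality reads \<open>M * m * (t + M) \<le> (m + t)^3\<close>. Its left side increases with \<open>M\<close>, so it is
  enough to look at \<open>M = m + t\<close>, where it becomes \<open>m * (m + 2 * t) \<le> (m + t)^2\<close>.

  The loss in this last step is only \<open>t^2\<close>. Hence the constant is sharp in the limit of small
  \<open>t / m\<close> for pairs of points with \<open>M = m + t\<close>, that is, pairs on a segment that runs straight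
  to a nearest boundary point. The unit ball with its centre and a point tending to the centre is
  such a configuration in every dimension, and there \<open>u = 3 * t + o(t)\<close> while
  \<open>j = t + o(t)\<close>.
\<close>

lemma bdist_pos:
  fixes D :: "'a::real_normed_vector set"
  assumes "open D" "D \<noteq> UNIV" "x \<in> D"
  shows "0 < bdist D x"
proof -
  have "frontier D \<noteq> {}"
    using assms frontier_eq_empty[of D] by auto
  moreover have "x \<notin> frontier D"
    using assms by (simp add: frontier_def interior_open)
  ultimately show ?thesis
    unfolding bdist_def by (intro infdist_pos_not_in_closed) auto
qed

lemma bdist_lipschitz: "bdist D x \<le> bdist D y + norm (x - y)"
  unfolding bdist_def dist_norm[symmetric] by (rule infdist_triangle)

lemma dist_ratio_commute: "dist_ratio D x y = dist_ratio D y x"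
  by (simp add: dist_ratio_def norm_minus_commute mult.commute)

lemma gromov_u_commute: "gromov_u D x y = gromov_u D y x"
  by (simp add: gromov_u_def norm_minus_commute mult.commute max.commute)

text \<open>
  In the four quantities \<open>ln M\<close>, \<open>ln m\<close>, \<open>ln (t + M)\<close> and \<open>ln (m + t)\<close> the claim is linear; it
  is the logarithm of the cubic inequality.
\<close>

lemma log_inequality:
  fixes m M t :: real
  assumes "0 < m" "m \<le> M" "M \<le> m + t"
  shows "2 * ln ((t + M) / sqrt (M * m)) \<le> 3 * (1 / 2 * ln ((1 + t / M) * (1 + t / m)))"
proof -
  have pos: "0 < M" "0 \<le> t" "0 < t + M" "0 < m + t"
    using assms by auto
  have "M * m * (t + M) \<le> (m + t) * m * (t + (m + t))"
    using assms pos by (intro mult_mono) auto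
  also have "\<dots> = (m + t) * ((m + t)^2 - t^2)"
    by (simp add: power2_eq_square algebra_simps)
  also have "\<dots> \<le> (m + t) * (m + t)^2"
    using pos by (intro mult_left_mono) auto
  also have "\<dots> = (m + t)^3"
    by (simp add: power2_eq_square power3_eq_cube)
  finally have "ln (M * m * (t + M)) \<le> ln ((m + t)^3)"
    using assms pos by (subst ln_le_cancel_iff) auto
  then have cubic: "ln M + ln m + ln (t + M) \<le> 3 * ln (m + t)"
    using assms pos by (simp add: ln_mult ln_realpow)
  have u: "ln ((t + M) / sqrt (M * m)) = ln (t + M) - (ln M + ln m) / 2"
    using assms pos by (simp add: ln_div ln_mult ln_sqrt)
  have "(1 + t / M) * (1 + t / m) = (t + M) * (m + t) / (M * m)"
    using assms pos by (simp add: field_simps)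
  then have j: "ln ((1 + t / M) * (1 + t / m)) = ln (t + M) + ln (m + t) - ln M - ln m"
    using assms pos by (simp add: ln_div ln_mult)
  show ?thesis
    unfolding u j using cubic by (simp add: field_simps)
qed

lemma gromov_u_le_dist_ratio:
  fixes D :: "'a::real_normed_vector set"
  assumes "open D" "D \<noteq> UNIV" "x \<in> D" "y \<in> D"
  shows "gromov_u D x y \<le> 3 * dist_ratio D x y"
proof -
  have ordered: "gromov_u D x y \<le> 3 * dist_ratio D x y"
    if "x \<in> D" "y \<in> D" and le: "bdist D y \<le> bdist D x" for x y
    using log_inequality[OF bdist_pos[OF assms(1,2) \<open>y \<in> D\<close>] le bdist_lipschitz[of D x y]] le
    by (simp add: gromov_u_def dist_ratio_def max_absorb1)
  show ?thesis
    using ordered[of x y] ordered[of y x] assms(3,4)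
    by (cases "bdist D y \<le> bdist D x")
      (auto simp: gromov_u_commute[of D x y] dist_ratio_commute[of D x y])
qed

text \<open>A nearest boundary point to \<open>s *\<^sub>R e\<close> is \<open>e\<close> itself.\<close>

lemma bdist_unit_ball:
  fixes e :: "'a::real_normed_vector"
  assumes "norm e = 1" "0 \<le> s" "s < 1"
  shows "bdist (ball 0 1) (s *\<^sub>R e) = 1 - s"
proof -
  have frontier: "frontier (ball (0::'a) 1) = sphere 0 1"
    by simp
  have e: "e \<in> sphere 0 1"
    using assms by simp
  have "dist (s *\<^sub>R e) e = norm ((s - 1) *\<^sub>R e)"
    by (simp add: dist_norm scaleR_left_diff_distrib)
  then have "infdist (s *\<^sub>R e) (sphere 0 1) \<le> 1 - s"
    using infdist_le[OF e, of "s *\<^sub>R e"] assms by simp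
  moreover have "1 - s \<le> infdist (s *\<^sub>R e) (sphere 0 1)"
  proof -
    have "1 - s \<le> dist (s *\<^sub>R e) z" if "z \<in> sphere 0 1" for z
      using that assms norm_triangle_ineq2[of z "s *\<^sub>R e"]
      by (simp add: dist_norm norm_minus_commute)
    then show ?thesis
      using e by (subst infdist_notempty) (auto intro!: cINF_greatest)
  qed
  ultimately show ?thesis
    unfolding bdist_def frontier by simp
qed

lemma unit_ball_radial_metrics:
  fixes e :: "'a::real_normed_vector"
  assumes "norm e = 1" "0 < t" "t < 1"
  shows "gromov_u (ball 0 1) 0 (t *\<^sub>R e) = 2 * ln (1 + t) - ln (1 - t)"
    and "dist_ratio (ball 0 1) 0 (t *\<^sub>R e) = (ln (1 + t) - ln (1 - t)) / 2"
proof -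
  have b: "bdist (ball 0 1) (0::'a) = 1" "bdist (ball 0 1) (t *\<^sub>R e) = 1 - t"
    using bdist_unit_ball[of e 0] bdist_unit_ball[of e t] assms by auto
  have n: "norm (0 - t *\<^sub>R e) = t"
    using assms by simp
  show "gromov_u (ball 0 1) 0 (t *\<^sub>R e) = 2 * ln (1 + t) - ln (1 - t)"
    unfolding gromov_u_def b n using assms
    by (simp add: ln_div ln_sqrt max_def add.commute)
  have "(1 + t / 1) * (1 + t / (1 - t)) = (1 + t) / (1 - t)"
    using assms by (simp add: field_simps)
  then show "dist_ratio (ball 0 1) 0 (t *\<^sub>R e) = (ln (1 + t) - ln (1 - t)) / 2"
    unfolding dist_ratio_def b n using assms by (simp add: ln_div)
qed

lemma unit_ball_constant_ge_3:
  fixes e :: "'a::real_normed_vector"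
  assumes e: "norm e = 1"
    and bound: "\<And>x y :: 'a. x \<in> ball 0 1 \<Longrightarrow> y \<in> ball 0 1 \<Longrightarrow>
      gromov_u (ball 0 1) x y \<le> c * dist_ratio (ball 0 1) x y"
  shows "3 \<le> c"
proof -
  define q :: "real \<Rightarrow> real" where
    "q t = (2 * ln (1 + t) - ln (1 - t)) / ((ln (1 + t) - ln (1 - t)) / 2)" for t
  have lim: "(q \<longlongrightarrow> 3) (at_right 0)"
    unfolding q_def by real_asymp
  have "q t \<le> c" if t: "0 < t" "t < 1" for t
  proof -
    have "gromov_u (ball 0 1) 0 (t *\<^sub>R e) \<le> c * dist_ratio (ball 0 1) 0 (t *\<^sub>R e)"
      using bound[of 0 "t *\<^sub>R e"] e t by simp
    moreover have "ln (1 - t) < ln (1 + t)"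
      using t by simp
    ultimately show ?thesis
      unfolding unit_ball_radial_metrics[OF e t] q_def by (simp add: pos_divide_le_eq)
  qed
  then have "eventually (\<lambda>t. q t \<le> c) (at_right 0)"
    using eventually_at_right_real[of 0 1] by (auto elim!: eventually_mono)
  then show ?thesis
    by (intro tendsto_upperbound[OF lim]) auto
qed

theorem theorem4p2:
  shows "(\<forall>D :: (real ^ 'n) set. domain D \<and> D \<noteq> UNIV \<longrightarrow>
            (\<forall>x\<in>D. \<forall>y\<in>D. gromov_u D x y \<le> 3 * dist_ratio D x y)) \<and>
         (\<forall>c :: real. c < 3 \<longrightarrow>
            \<not> (\<forall>D :: (real ^ 'n) set. domain D \<and> D \<noteq> UNIV \<longrightarrow>
                  (\<forall>x\<in>D. \<forall>y\<in>D. gromov_u D x y \<le> c * dist_ratio D x y)))"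
proof (intro conjI allI impI notI)
  fix D :: "(real ^ 'n) set"
  assume "domain D \<and> D \<noteq> UNIV"
  then show "\<forall>x\<in>D. \<forall>y\<in>D. gromov_u D x y \<le> 3 * dist_ratio D x y"
    by (auto simp: domain_def intro: gromov_u_le_dist_ratio)
next
  fix c :: real
  assume "c < 3"
    and bound: "\<forall>D :: (real ^ 'n) set. domain D \<and> D \<noteq> UNIV \<longrightarrow>
      (\<forall>x\<in>D. \<forall>y\<in>D. gromov_u D x y \<le> c * dist_ratio D x y)"
  obtain e :: "real ^ 'n" where e: "norm e = 1"
    using vector_choose_size[of 1] by auto
  have "domain (ball (0 :: real ^ 'n) 1)"
    by (simp add: domain_def)
  moreover have "e \<notin> ball 0 1"
    using e by simp
  then have "ball (0 :: real ^ 'n) 1 \<noteq> UNIV"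
    by blast
  ultimately have "3 \<le> c"
    using bound by (intro unit_ball_constant_ge_3[OF e]) blast
  with \<open>c < 3\<close> show False
    by simp
qed

end
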